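(* Let $K$ denote the complete elliptic integral of the first kind. The function $$x\mapsto\frac{1}{1+x}K\left(\frac{x}{1+x}\right),\quad x\geq 0,$$ is completely monotonic. Consequently there exists a finite positive Borel measure $\mu$ on $[0,\infty)$ such that $$K(x)=\frac{1}{1-x}\int_{0}^{\infty}e^{-\frac{x}{1-x}t}\,d\mu(t),\quad x\in[0,1).$$
   Context: $K$ is taken as a function of the modulus: $K(x)=\int_0^{\pi/2}\frac{d\theta}{\sqrt{1-x^2\sin^2\theta}}$ for $x\in[0,1)$; equivalently $K(x)=\frac{\pi}{2}\,{}_2F_1\left(\frac12,\frac12;1;x^2\right)$. A function $f:[0,\infty)\to\mathbb{R}$ is completely monotonic (in the sense of Bernstein's theorem) if it is continuous on $[0,\infty)$, infinitely differentiable on $(0,\infty)$, and $(-1)^m f^{(m)}(x)\geq 0$ for all $x>0$ and all integers $m\geq 0$. *)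

theory Defs
  imports "HOL-Analysis.Analysis"
begin

text \<open>The argument is the modulus, not the parameter \<open>m = x\<^sup>2\<close>; only
  \<open>0 \<le> x < 1\<close> is meaningful.\<close>

definition ellipticK :: "real \<Rightarrow> real" where
  "ellipticK x = integral {0..pi / 2} (\<lambda>\<theta>. 1 / sqrt (1 - x\<^sup>2 * (sin \<theta>)\<^sup>2))"

text \<open>A function on \<open>[0, \<infinity>)\<close> is represented by a total function on the reals; its values at
  negative arguments are irrelevant, since derivatives are only taken at points \<open>x > 0\<close>.\<close>

definition completely_monotonic :: "(real \<Rightarrow> real) \<Rightarrow> bool" where
  "completely_monotonic f \<longleftrightarrow>
     continuous_on {0..} f \<and>
     (\<forall>m::nat. \<forall>x>0. (deriv ^^ m) f differentiable (at x)) \<and>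
     (\<forall>m::nat. \<forall>x>0. (- 1) ^ m * (deriv ^^ m) f x \<ge> 0)"

end

(* With s = sin \<theta>,
     1/(1+x) K(x/(1+x)) = \<integral> d\<theta> / sqrt ((1 + x(1-s)) (1 + x(1+s)))   over 0 \<le> \<theta> \<le> \<pi>/2,
   and 1/sqrt(1+c) is the expectation of exp(-c Z^2/2) for a standard Gaussian Z.  The integrand is
   therefore the expectation of exp(-x h) with h = ((1-s) Z^2 + (1+s) W^2)/2 \<ge> 0, for Z, W independent.
   So the function is the Laplace transform of the image under h of the product of Lebesgue measure
   on [0, \<pi>/2] with two Gaussian measures, and Laplace transforms of finite measures on [0, \<infinity>) are
   completely monotonic. *)

theory Submission
  imports Defs "HOL-Probability.Characteristic_Functions"
begin

section \<open>Laplace transforms of finite measures\<close>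

text \<open>One term of the exponential series of \<open>c * t\<close> is at most the whole sum,
  since all terms are nonnegative. The bound does not depend on \<open>t\<close>, so it gives
  integrability against every finite measure on the half-line.\<close>

lemma power_times_exp_le:
  fixes t c :: real
  assumes "t \<ge> 0" "c > 0"
  shows "t ^ k * exp (- (c * t)) \<le> fact k / c ^ k"
proof -
  have "(\<Sum>n\<in>{k}. (c * t) ^ n /\<^sub>R fact n) \<le> (\<Sum>n. (c * t) ^ n /\<^sub>R fact n)"
    using assms by (intro sum_le_suminf summable_exp_generic) auto
  then have "(c * t) ^ k / fact k \<le> exp (c * t)"
    by (simp add: exp_def divide_inverse mult.commute)
  then show ?thesis
    using assms by (simp add: field_simps exp_minus)
qed

text \<open>Second-order Taylor expansion with Lagrange remainder: the intermediate point is no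
  larger than \<open>v\<close> in absolute value, and the factor 1/2 is given away.\<close>

lemma abs_exp_minus_one_minus_le:
  fixes v :: real
  shows "\<bar>exp v - 1 - v\<bar> \<le> v\<^sup>2 * exp \<bar>v\<bar>"
proof -
  obtain t where t: "\<bar>t\<bar> \<le> \<bar>v\<bar>"
    "exp v = (\<Sum>m<2. v ^ m / fact m) + exp t / fact 2 * v ^ 2"
    using Maclaurin_exp_le[of v 2] by auto
  have "exp v - 1 - v = exp t / 2 * v\<^sup>2"
    using t(2) by (simp add: eval_nat_numeral)
  moreover have "exp t / 2 \<le> exp \<bar>v\<bar>"
  proof -
    have "exp t \<le> exp \<bar>v\<bar>" "0 < exp t" using t(1) by auto
    then show ?thesis by linarith
  qed
  then have "exp t / 2 * v\<^sup>2 \<le> exp \<bar>v\<bar> * v\<^sup>2"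
    by (rule mult_right_mono) simp
  ultimately show ?thesis
    by (simp only: abs_mult mult.commute) simp
qed

lemma borel_measurable_halfline:
  fixes g :: "real \<Rightarrow> real"
  assumes "sets \<mu> = sets (restrict_space borel {0::real..})" "g \<in> borel_measurable borel"
  shows "g \<in> borel_measurable \<mu>"
  using measurable_restrict_space1[OF assms(2)] measurable_cong_sets[OF assms(1) refl] by blast

lemma space_halfline:
  assumes "sets \<mu> = sets (restrict_space borel {0::real..})"
  shows "space \<mu> = {0..}"
  using sets_eq_imp_space_eq[OF assms] by (simp add: space_restrict_space)

lemma integrable_power_times_exp:
  fixes \<mu> :: "real measure"
  assumes "finite_measure \<mu>" and \<mu>: "sets \<mu> = sets (restrict_space borel {0..})" and "x > 0"
  shows "integrable \<mu> (\<lambda>t. t ^ k * exp (- (x * t)))"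
proof (rule finite_measure.integrable_const_bound[OF assms(1)])
  show "AE t in \<mu>. norm (t ^ k * exp (- (x * t))) \<le> fact k / x ^ k"
    using power_times_exp_le[OF _ \<open>x > 0\<close>, of _ k] by (intro AE_I2) (simp add: space_halfline[OF \<mu>])
qed (intro borel_measurable_halfline[OF \<mu>], measurable)

text \<open>Differentiation under the integral sign, through an explicit estimate: the first-order
  Taylor error of the m-th integral at \<open>x\<close> is at most \<open>h\<^sup>2 * C\<close> with
  \<open>C\<close> independent of \<open>h\<close>.\<close>

lemma DERIV_laplace_transform:
  fixes \<mu> :: "real measure"
  assumes fin: "finite_measure \<mu>" and \<mu>: "sets \<mu> = sets (restrict_space borel {0..})" and "x > 0"
  shows "((\<lambda>x. \<integral>t. (- t) ^ m * exp (- (x * t)) \<partial>\<mu>) has_real_derivative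
          (\<integral>t. (- t) ^ Suc m * exp (- (x * t)) \<partial>\<mu>)) (at x)"
proof -
  define g where "g k y = (\<integral>t. (- t) ^ k * exp (- (y * t)) \<partial>\<mu>)" for k y
  \<comment> \<open>For \<open>\<bar>h\<bar> \<le> x / 2\<close> the factor
    \<open>exp \<bar>h * t\<bar>\<close> in the Taylor bound uses up at most half of the decay of
    \<open>exp (- (x * t))\<close>, leaving \<open>exp (- (x / 2 * t))\<close>. The two extra powers
    of \<open>t\<close> come from \<open>(h * t)\<^sup>2\<close>.\<close>
  define C where "C = (\<integral>t. t ^ (m + 2) * exp (- (x / 2 * t)) \<partial>\<mu>)"
  have int: "integrable \<mu> (\<lambda>t. (- t) ^ k * exp (- (y * t)))" if "y > 0" for k y
  proof -
    have "(\<lambda>t. (- t) ^ k * exp (- (y * t))) = (\<lambda>t. (- 1) ^ k * (t ^ k * exp (- (y * t))))"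
      by (simp add: mult.assoc[symmetric] power_mult_distrib[symmetric])
    then show ?thesis
      using integrable_power_times_exp[OF fin \<mu> that] by simp
  qed
  have bound: "\<bar>g m (x + h) - g m x - h * g (Suc m) x\<bar> \<le> h\<^sup>2 * C" if h: "\<bar>h\<bar> \<le> x / 2" for h
  proof -
    have pos: "x + h > 0" using h \<open>x > 0\<close> by linarith
    have diff: "g m (x + h) - g m x - h * g (Suc m) x =
       (\<integral>t. (- t) ^ m * exp (- ((x + h) * t)) - (- t) ^ m * exp (- (x * t))
           - h * ((- t) ^ Suc m * exp (- (x * t))) \<partial>\<mu>)"
      unfolding g_def using int[OF pos] int[OF \<open>x > 0\<close>]
      by (simp del: power_Suc)
    have "\<bar>g m (x + h) - g m x - h * g (Suc m) x\<bar> \<le> (\<integral>t. h\<^sup>2 * (t ^ (m + 2) * exp (- (x / 2 * t))) \<partial>\<mu>)"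
      unfolding diff
    proof (rule integral_abs_bound[THEN order_trans], rule integral_mono)
      show "integrable \<mu> (\<lambda>t. \<bar>(- t) ^ m * exp (- ((x + h) * t)) - (- t) ^ m * exp (- (x * t))
           - h * ((- t) ^ Suc m * exp (- (x * t)))\<bar>)"
        using int[OF pos] int[OF \<open>x > 0\<close>]
        by (intro integrable_abs Bochner_Integration.integrable_diff integrable_mult_right)
      show "integrable \<mu> (\<lambda>t. h\<^sup>2 * (t ^ (m + 2) * exp (- (x / 2 * t))))"
        using integrable_power_times_exp[OF fin \<mu>, of "x / 2" "m + 2"] \<open>x > 0\<close> by simp
    next
      fix t assume "t \<in> space \<mu>"
      then have t: "t \<ge> 0" by (simp add: space_halfline[OF \<mu>])
      have "(- t) ^ m * exp (- ((x + h) * t)) - (- t) ^ m * exp (- (x * t))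
           - h * ((- t) ^ Suc m * exp (- (x * t)))
         = (- t) ^ m * (exp (- (x * t)) * (exp (- (h * t)) - 1 - (- (h * t))))"
        by (simp add: algebra_simps exp_add[symmetric])
      also have "\<bar>\<dots>\<bar> = t ^ m * (exp (- (x * t)) * \<bar>exp (- (h * t)) - 1 - (- (h * t))\<bar>)"
        using t by (simp add: abs_mult power_abs)
      also have "\<dots> \<le> t ^ m * (exp (- (x * t)) * ((h * t)\<^sup>2 * exp (x / 2 * t)))"
      proof (intro mult_left_mono)
        have "\<bar>h * t\<bar> \<le> x / 2 * t" using mult_right_mono[OF h t] t by (simp add: abs_mult)
        then have "(h * t)\<^sup>2 * exp \<bar>h * t\<bar> \<le> (h * t)\<^sup>2 * exp (x / 2 * t)"
          by (intro mult_left_mono) auto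
        then show "\<bar>exp (- (h * t)) - 1 - (- (h * t))\<bar> \<le> (h * t)\<^sup>2 * exp (x / 2 * t)"
          using abs_exp_minus_one_minus_le[of "- (h * t)"] by simp
      qed (use t in auto)
      also have "\<dots> = h\<^sup>2 * (t ^ (m + 2) * (exp (- (x * t)) * exp (x / 2 * t)))"
        by (simp add: power2_eq_square power_add mult_ac)
      also have "exp (- (x * t)) * exp (x / 2 * t) = exp (- (x / 2 * t))"
        by (simp add: exp_add[symmetric])
      finally show "\<bar>(- t) ^ m * exp (- ((x + h) * t)) - (- t) ^ m * exp (- (x * t))
           - h * ((- t) ^ Suc m * exp (- (x * t)))\<bar> \<le> h\<^sup>2 * (t ^ (m + 2) * exp (- (x / 2 * t)))" .
    qed
    then show ?thesis by (simp add: C_def)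
  qed
  \<comment> \<open>Dividing the quadratic error by \<open>\<bar>h\<bar>\<close> leaves
    \<open>\<bar>h\<bar> * C\<close>, which tends to 0.\<close>
  have "((\<lambda>h. (g m (x + h) - g m x) / h - g (Suc m) x) \<longlongrightarrow> 0) (at 0)"
  proof (rule Lim_null_comparison)
    show "\<forall>\<^sub>F h in at 0. norm ((g m (x + h) - g m x) / h - g (Suc m) x) \<le> \<bar>h\<bar> * C"
      unfolding eventually_at
    proof (intro exI conjI ballI impI)
      fix h :: real assume h: "h \<noteq> 0 \<and> dist h 0 < x / 2"
      have "norm ((g m (x + h) - g m x) / h - g (Suc m) x)
          = \<bar>g m (x + h) - g m x - h * g (Suc m) x\<bar> / \<bar>h\<bar>"
        using h by (simp add: abs_divide[symmetric] diff_divide_distrib)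
      also have "\<dots> \<le> h\<^sup>2 * C / \<bar>h\<bar>"
        using h by (intro divide_right_mono bound) auto
      also have "\<dots> = \<bar>h\<bar> * C"
        using h by (simp add: power2_eq_square abs_if)
      finally show "norm ((g m (x + h) - g m x) / h - g (Suc m) x) \<le> \<bar>h\<bar> * C" .
    qed (use \<open>x > 0\<close> in simp)
    show "((\<lambda>h. \<bar>h\<bar> * C) \<longlongrightarrow> 0) (at 0)" by (auto intro!: tendsto_eq_intros)
  qed
  then have "(g m has_real_derivative g (Suc m) x) (at x)"
    by (simp add: DERIV_def LIM_zero_iff)
  then show ?thesis by (simp add: g_def[abs_def])
qed

text \<open>The easy direction of Bernstein's theorem: each derivative brings down a factor
  \<open>- t\<close>, so the sign \<open>(- 1) ^ m\<close> turns the integrand into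
  \<open>t ^ m * exp (- (x * t))\<close>, which is nonnegative because the measure lives on the
  half-line.\<close>

lemma completely_monotonic_laplace_transform:
  fixes \<mu> :: "real measure"
  assumes fin: "finite_measure \<mu>" and \<mu>: "sets \<mu> = sets (restrict_space borel {0..})"
    and f: "\<And>x. x \<ge> 0 \<Longrightarrow> f x = (\<integral>t. exp (- (x * t)) \<partial>\<mu>)"
  shows "completely_monotonic f"
proof -
  define g where "g k y = (\<integral>t. (- t) ^ k * exp (- (y * t)) \<partial>\<mu>)" for k y
  have cont: "continuous_on {0..} f"
    unfolding continuous_on_sequentially comp_def
  proof (intro allI ballI impI, elim conjE)
    fix u :: "nat \<Rightarrow> real" and a assume a: "a \<in> {0..}" and u: "\<forall>n. u n \<in> {0..}" "u \<longlonglongrightarrow> a"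
    have "(\<lambda>n. \<integral>t. exp (- (u n * t)) \<partial>\<mu>) \<longlonglongrightarrow> (\<integral>t. exp (- (a * t)) \<partial>\<mu>)"
    \<comment> \<open>Since \<open>u n\<close> and \<open>t\<close> are nonnegative, the constant 1
      dominates, and it is integrable as the measure is finite. This covers the endpoint
      \<open>a = 0\<close>, which the derivative formula does not reach.\<close>
    proof (rule integral_dominated_convergence[where w = "\<lambda>_. 1"])
      show "integrable \<mu> (\<lambda>_. 1::real)" using fin by (simp add: finite_measure.integrable_const)
      show "AE t in \<mu>. (\<lambda>n. exp (- (u n * t))) \<longlonglongrightarrow> exp (- (a * t))"
        using u(2) by (intro AE_I2 tendsto_intros)
      show "AE t in \<mu>. norm (exp (- (u n * t))) \<le> 1" for n
        using u(1) by (intro AE_I2) (simp add: space_halfline[OF \<mu>])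
    qed (intro borel_measurable_halfline[OF \<mu>], measurable)+
    then show "(\<lambda>n. f (u n)) \<longlonglongrightarrow> f a" using a u(1) by (simp add: f)
  qed
  have eq: "(deriv ^^ m) f x = g m x" if "x > 0" for m x
    using that
  proof (induction m arbitrary: x)
    case 0
    then show ?case by (simp add: f g_def)
  next
    case (Suc m)
    \<comment> \<open>The induction hypothesis identifies the m-th derivative with
      \<open>g m\<close> only at positive points. These form an open set, so the derivative of
      \<open>g m\<close> carries over.\<close>
    have "((deriv ^^ m) f has_real_derivative g (Suc m) x) (at x)"
      by (rule has_field_derivative_transform_within_open[of "g m" _ _ "{0<..}"])
        (use Suc DERIV_laplace_transform[OF fin \<mu>] in \<open>auto simp: g_def[abs_def]\<close>)
    then show ?case by (simp add: DERIV_imp_deriv)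
  qed
  have "(deriv ^^ m) f differentiable (at x)" if "x > 0" for m x
  proof -
    have "((deriv ^^ m) f has_real_derivative g (Suc m) x) (at x)"
      by (rule has_field_derivative_transform_within_open[of "g m" _ _ "{0<..}"])
        (use eq that DERIV_laplace_transform[OF fin \<mu>] in \<open>auto simp: g_def[abs_def]\<close>)
    then show ?thesis by (auto simp: real_differentiable_def)
  qed
  moreover have "(- 1) ^ m * (deriv ^^ m) f x \<ge> 0" if "x > 0" for m x
  proof -
    have "(- 1) ^ m * (deriv ^^ m) f x = (\<integral>t. (- 1) ^ m * ((- t) ^ m * exp (- (x * t))) \<partial>\<mu>)"
      by (simp add: eq[OF that] g_def)
    also have "\<dots> = (\<integral>t. t ^ m * exp (- (x * t)) \<partial>\<mu>)"
      by (simp add: mult.assoc[symmetric] power_mult_distrib[symmetric])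
    also have "\<dots> \<ge> 0"
      by (intro integral_nonneg_AE AE_I2) (simp add: space_halfline[OF \<mu>])
    finally show ?thesis .
  qed
  ultimately show ?thesis using cont by (simp add: completely_monotonic_def)
qed

section \<open>The Gaussian representation\<close>

text \<open>The product of the standard Gaussian density and
  \<open>exp (- (c * z\<^sup>2 / 2))\<close> is \<sigma> times the centred Gaussian density of
  variance 1 / (1 + c), which has total mass 1.\<close>

lemma std_normal_integral_exp_square:
  fixes c :: real
  assumes "c \<ge> 0"
  shows "(\<integral>z. exp (- (c * z\<^sup>2 / 2)) \<partial>std_normal_distribution) = 1 / sqrt (1 + c)"
proof -
  define \<sigma> where "\<sigma> = 1 / sqrt (1 + c)"
  have \<sigma>: "\<sigma> > 0" "\<sigma>\<^sup>2 = 1 / (1 + c)" using assms by (auto simp: \<sigma>_def power_divide)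
  have "std_normal_density z * exp (- (c * z\<^sup>2 / 2)) = \<sigma> * normal_density 0 \<sigma> z" for z
  proof -
    have "std_normal_density z * exp (- (c * z\<^sup>2 / 2)) = 1 / sqrt (2 * pi) * exp (- ((1 + c) * z\<^sup>2 / 2))"
      unfolding std_normal_density_def by (simp add: exp_add[symmetric] field_simps)
    also have "(1 + c) * z\<^sup>2 / 2 = z\<^sup>2 / (2 * \<sigma>\<^sup>2)"
      using assms by (simp add: \<sigma>(2) field_simps)
    also have "1 / sqrt (2 * pi) * exp (- (z\<^sup>2 / (2 * \<sigma>\<^sup>2))) = \<sigma> * normal_density 0 \<sigma> z"
      using \<sigma>(1) by (simp add: normal_density_def real_sqrt_mult)
    finally show ?thesis .
  qed
  then have "(\<integral>z. exp (- (c * z\<^sup>2 / 2)) \<partial>std_normal_distribution) = (\<integral>z. \<sigma> * normal_density 0 \<sigma> z \<partial>lborel)"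
    by (simp add: integral_density)
  also have "\<dots> = \<sigma>" using \<sigma>(1) by simp
  finally show ?thesis by (simp add: \<sigma>_def)
qed

text \<open>The radicand \<open>(1 + x)\<^sup>2 - x\<^sup>2 * (sin \<theta>)\<^sup>2\<close> is a
  difference of squares. Both factors have the form 1 + c with c nonnegative, as the Gaussian
  formula requires.\<close>

lemma ellipticK_shifted_eq:
  fixes x :: real
  assumes "x \<ge> 0"
  shows "1 / (1 + x) * ellipticK (x / (1 + x)) =
    (\<integral>\<theta>. 1 / sqrt (1 + x * (1 - sin \<theta>)) * (1 / sqrt (1 + x * (1 + sin \<theta>)))
      \<partial>restrict_space lborel {0..pi / 2})"
proof -
  let ?r = "\<lambda>\<theta>. 1 / sqrt (1 + x * (1 - sin \<theta>)) * (1 / sqrt (1 + x * (1 + sin \<theta>)))"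
  have pos: "1 + x * (1 - sin \<theta>) > 0" "1 + x * (1 + sin \<theta>) > 0" for \<theta>
    using assms sin_ge_minus_one[of \<theta>] sin_le_one[of \<theta>]
    by (intro add_pos_nonneg mult_nonneg_nonneg; linarith)+
  have eq: "1 / (1 + x) * (1 / sqrt (1 - (x / (1 + x))\<^sup>2 * (sin \<theta>)\<^sup>2)) = ?r \<theta>" for \<theta>
  proof -
    have "(1 + x * (1 - sin \<theta>)) * (1 + x * (1 + sin \<theta>))
        = (1 + x)\<^sup>2 * (1 - (x / (1 + x))\<^sup>2 * (sin \<theta>)\<^sup>2)"
      using assms by (simp add: power_divide right_diff_distrib) (simp add: power2_eq_square algebra_simps)
    then have "sqrt (1 + x * (1 - sin \<theta>)) * sqrt (1 + x * (1 + sin \<theta>))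
        = (1 + x) * sqrt (1 - (x / (1 + x))\<^sup>2 * (sin \<theta>)\<^sup>2)"
      using assms by (simp add: real_sqrt_mult[symmetric]) (simp add: real_sqrt_mult)
    then show ?thesis by simp
  qed
  have "continuous_on {0..pi / 2} ?r"
    using pos by (intro continuous_intros) (auto simp: less_imp_neq[symmetric])
  \<comment> \<open>Absolute integrability identifies the Lebesgue integral with the gauge integral
    in \<open>ellipticK_def\<close>.\<close>
  then have "set_integrable lborel {0..pi / 2} ?r"
    by (rule borel_integrable_atLeastAtMost')
  then have "(LINT \<theta>:{0..pi / 2}|lborel. ?r \<theta>) = integral {0..pi / 2} ?r"
    by (rule set_borel_integral_eq_integral)
  also have "\<dots> = 1 / (1 + x) * ellipticK (x / (1 + x))"
    unfolding ellipticK_def by (subst integral_mult_right[symmetric]) (simp only: eq)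
  finally show ?thesis
    by (simp add: set_lebesgue_integral_def integral_restrict_space)
qed

lemma ellipticK_shifted_laplace:
  obtains \<mu> :: "real measure"
  where "finite_measure \<mu>" "sets \<mu> = sets (restrict_space borel {0..})"
    "\<And>x. x \<ge> 0 \<Longrightarrow> 1 / (1 + x) * ellipticK (x / (1 + x)) = (\<integral>t. exp (- (x * t)) \<partial>\<mu>)"
proof
  let ?N = "std_normal_distribution"
  define U where "U = restrict_space lborel {0..pi / 2}"
  define P where "P = U \<Otimes>\<^sub>M (?N \<Otimes>\<^sub>M ?N)"
  define h :: "real \<times> real \<times> real \<Rightarrow> real"
    where "h = (\<lambda>(\<theta>, z, w). ((1 - sin \<theta>) * z\<^sup>2 + (1 + sin \<theta>) * w\<^sup>2) / 2)"
  \<comment> \<open>The image measure is taken directly on the half-line, which is legitimate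
    because \<open>h\<close> is nonnegative everywhere.\<close>
  define \<mu> where "\<mu> = distr P (restrict_space borel {0..}) h"
  interpret N: prob_space ?N by (rule prob_space_normal_density) simp
  interpret U: finite_measure U
    by (rule finite_measureI) (simp add: U_def emeasure_restrict_space space_restrict_space)
  interpret NN: pair_prob_space ?N ?N ..
  interpret P: pair_sigma_finite U "?N \<Otimes>\<^sub>M ?N" ..
  interpret P': finite_measure P
    unfolding P_def by (intro finite_measure_pair_measure U.finite_measure_axioms NN.P.finite_measure_axioms)
  have h_nonneg: "h p \<ge> 0" for p
  proof -
    have "1 - sin (fst p) \<ge> 0" "1 + sin (fst p) \<ge> 0"
      using sin_ge_minus_one[of "fst p"] sin_le_one[of "fst p"] by linarith+
    then show ?thesis by (simp add: h_def split_beta)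
  qed
  have [measurable]: "sin \<in> borel_measurable U"
    unfolding U_def by (intro measurable_restrict_space1) simp
  have h_borel [measurable]: "h \<in> borel_measurable P"
    unfolding h_def P_def by measurable
  have h_meas: "h \<in> measurable P (restrict_space borel {0..})"
    by (rule measurable_restrict_space2) (auto simp: h_nonneg)
  show "finite_measure \<mu>" unfolding \<mu>_def using h_meas by (rule P'.finite_measure_distr)
  show \<mu>_sets: "sets \<mu> = sets (restrict_space borel {0..})" by (simp add: \<mu>_def)
  fix x :: real assume x: "x \<ge> 0"
  have "(\<integral>t. exp (- (x * t)) \<partial>\<mu>) = (\<integral>p. exp (- (x * h p)) \<partial>P)"
    unfolding \<mu>_def by (intro integral_distr h_meas measurable_restrict_space1) simp
  also have "\<dots> = (\<integral>\<theta>. \<integral>q. exp (- (x * h (\<theta>, q))) \<partial>(?N \<Otimes>\<^sub>M ?N) \<partial>U)"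
  proof -
    \<comment> \<open>Fubini applies because the integrand is bounded by 1 and \<open>P\<close> is
      finite.\<close>
    have "integrable P (\<lambda>p. exp (- (x * h p)))"
      by (rule P'.integrable_const_bound[where B = 1]) (use x h_nonneg in auto)
    then show ?thesis
      using P.integral_fst'[of "\<lambda>p. exp (- (x * h p))"] by (simp add: P_def)
  qed
  also have "\<dots> = (\<integral>\<theta>. 1 / sqrt (1 + x * (1 - sin \<theta>)) * (1 / sqrt (1 + x * (1 + sin \<theta>))) \<partial>U)"
  proof (intro Bochner_Integration.integral_cong refl)
    fix \<theta>
    let ?e = "\<lambda>c z::real. exp (- (x * c * z\<^sup>2 / 2))"
    have nn: "x * (1 - sin \<theta>) \<ge> 0" "x * (1 + sin \<theta>) \<ge> 0"
      using x sin_ge_minus_one[of \<theta>] sin_le_one[of \<theta>] by (intro mult_nonneg_nonneg; linarith)+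
    \<comment> \<open>For fixed \<theta> the exponent is a sum of a function of \<open>z\<close> and
      a function of \<open>w\<close>, so the double integral becomes a product of two Gaussian
      integrals, with c equal to \<open>x * (1 - sin \<theta>)\<close> and
      \<open>x * (1 + sin \<theta>)\<close>.\<close>
    have split: "exp (- (x * h (\<theta>, z, w))) = ?e (1 - sin \<theta>) z * ?e (1 + sin \<theta>) w" for z w
      unfolding h_def exp_add[symmetric] by (simp add: field_simps)
    have "integrable (?N \<Otimes>\<^sub>M ?N) (\<lambda>q. ?e (1 - sin \<theta>) (fst q) * ?e (1 + sin \<theta>) (snd q))"
    proof (rule NN.P.integrable_const_bound[where B = 1])
      show "AE q in ?N \<Otimes>\<^sub>M ?N. norm (?e (1 - sin \<theta>) (fst q) * ?e (1 + sin \<theta>) (snd q)) \<le> 1"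
        using nn by (intro AE_I2) (auto simp: abs_mult intro!: mult_le_one)
    qed measurable
    then have "(\<integral>q. ?e (1 - sin \<theta>) (fst q) * ?e (1 + sin \<theta>) (snd q) \<partial>(?N \<Otimes>\<^sub>M ?N))
        = (\<integral>z. \<integral>w. ?e (1 - sin \<theta>) z * ?e (1 + sin \<theta>) w \<partial>?N \<partial>?N)"
      using NN.integral_fst'[of "\<lambda>q. ?e (1 - sin \<theta>) (fst q) * ?e (1 + sin \<theta>) (snd q)"] by simp
    also have "\<dots> = (\<integral>z. ?e (1 - sin \<theta>) z \<partial>?N) * (\<integral>w. ?e (1 + sin \<theta>) w \<partial>?N)"
      by simp
    also have "\<dots> = 1 / sqrt (1 + x * (1 - sin \<theta>)) * (1 / sqrt (1 + x * (1 + sin \<theta>)))"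
      using nn by (simp only: std_normal_integral_exp_square)
    finally show "(\<integral>q. exp (- (x * h (\<theta>, q))) \<partial>(?N \<Otimes>\<^sub>M ?N))
        = 1 / sqrt (1 + x * (1 - sin \<theta>)) * (1 / sqrt (1 + x * (1 + sin \<theta>)))"
      \<comment> \<open>Instantiating \<open>split\<close> at the two components of \<open>q\<close>
        makes it applicable to the pair variable bound by the integral.\<close>
      by (simp add: split[of "fst q" "snd q" for q, simplified])
  qed
  finally show "1 / (1 + x) * ellipticK (x / (1 + x)) = (\<integral>t. exp (- (x * t)) \<partial>\<mu>)"
    using ellipticK_shifted_eq[OF x] by (simp add: U_def)
qed

theorem mainTheorem7:
  shows "completely_monotonic (\<lambda>x::real. 1 / (1 + x) * ellipticK (x / (1 + x))) \<and>
    (\<exists>\<mu> :: real measure.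
       sets \<mu> = sets (restrict_space borel {0..}) \<and> finite_measure \<mu> \<and>
       (\<forall>x::real. 0 \<le> x \<and> x < 1 \<longrightarrow>
          ellipticK x = 1 / (1 - x) * (\<integral>t. exp (- (x / (1 - x)) * t) \<partial>\<mu>)))"
proof -
  obtain \<mu> :: "real measure" where fin: "finite_measure \<mu>"
    and \<mu>: "sets \<mu> = sets (restrict_space borel {0..})"
    and eq: "\<And>x. x \<ge> 0 \<Longrightarrow> 1 / (1 + x) * ellipticK (x / (1 + x)) = (\<integral>t. exp (- (x * t)) \<partial>\<mu>)"
    using ellipticK_shifted_laplace by blast
  have "ellipticK x = 1 / (1 - x) * (\<integral>t. exp (- (x / (1 - x)) * t) \<partial>\<mu>)" if "0 \<le> x" "x < 1" for x
  proof -
    \<comment> \<open>The map x / (1 - x) inverts x / (1 + x), so the shifted identity at this point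
      returns \<open>ellipticK\<close> at \<open>x\<close> itself.\<close>
    have y: "1 + x / (1 - x) = 1 / (1 - x)" "x / (1 - x) / (1 / (1 - x)) = x"
      using that by (simp_all add: field_simps)
    have "(1 - x) * ellipticK x = (\<integral>t. exp (- (x / (1 - x)) * t) \<partial>\<mu>)"
      using eq[of "x / (1 - x)"] that unfolding y by simp
    then show ?thesis using that by (simp add: field_simps)
  qed
  then show ?thesis
    using completely_monotonic_laplace_transform[OF fin \<mu> eq] fin \<mu> by blast
qed

end
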